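(* For any positive integer $r$, every point $R\in\mathcal{M}_r'$ satisfies the LICQ condition, where $$\mathcal{M}_r'=\big\{R\in\mathbb{R}^{(n+2m)\times r}:\ A'R=b'e_1^\top,\ \operatorname{diag}_B(RR^\top)=R_Be_1\big\},\quad A'=\begin{pmatrix}A&I_m&0_{m\times m} \\ A&0_{m\times m}&-I_m\end{pmatrix},\quad b'=\begin{pmatrix}b \\ b\end{pmatrix}.$$
   Context: $n,m$ are positive integers, $A\in\mathbb{R}^{m\times n}$ has full row rank, $b\in\mathbb{R}^m$ with $b\ge0$, $B\subseteq[n]=\{1,\dots,n\}$ (so $B$ does not contain any of the last $2m$ indices). $e_1\in\mathbb{R}^r$ is the first standard unit vector, $\operatorname{diag}_B(X)=(X_{ii})_{i\in B}$, and $R_B$ is the submatrix of rows of $R$ indexed by $B$. A point $R\in\mathcal{M}_r'$ satisfies LICQ if the gradients at $R$ of the $2mr+|B|$ scalar equality constraint functions (the entries of $A'R-b'e_1^\top$ and of $\operatorname{diag}_B(RR^\top)-R_Be_1$) are linearly independent. *)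

theory Defs
  imports "HOL-Analysis.Analysis"
begin

text \<open>Dimensions are index types: \<open>n\<close>, \<open>m\<close>, \<open>r\<close> are the cardinalities of \<open>'n\<close>, \<open>'m\<close>, \<open>'r\<close>.
  The \<open>n + 2m\<close> variable rows are indexed by \<open>'n + ('m + 'm)\<close>, the \<open>2m\<close> linear equations by
  \<open>'m + 'm\<close>. A set \<open>B :: 'n set\<close> thus never meets the last \<open>2m\<close> row indices; its elements are
  embedded by \<open>Inl\<close>. Only \<open>'r\<close> is ordered, so that it has a first index.\<close>

definition e1 :: "real ^ 'r::{finite,linorder}" where
  "e1 = axis (Min UNIV) 1"

definition outer :: "real ^ 'k \<Rightarrow> real ^ 'r \<Rightarrow> real ^ 'r ^ 'k" where
  "outer u v = (\<chi> i j. u $ i * v $ j)"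

definition block_matrix :: "real ^ 'n ^ 'm \<Rightarrow> real ^ ('n + ('m + 'm)) ^ ('m + 'm)" where
  "block_matrix A = (\<chi> i j.
     case i of
       Inl p \<Rightarrow> (case j of Inl k \<Rightarrow> A $ p $ k
                        | Inr (Inl q) \<Rightarrow> mat 1 $ p $ q
                        | Inr (Inr q) \<Rightarrow> 0)
     | Inr p \<Rightarrow> (case j of Inl k \<Rightarrow> A $ p $ k
                        | Inr (Inl q) \<Rightarrow> 0
                        | Inr (Inr q) \<Rightarrow> - (mat 1 $ p $ q)))"

definition block_rhs :: "real ^ 'm \<Rightarrow> real ^ ('m + 'm)" where
  "block_rhs b = (\<chi> i. case i of Inl p \<Rightarrow> b $ p | Inr p \<Rightarrow> b $ p)"

definition feasible_set ::
  "real ^ 'n ^ 'm \<Rightarrow> real ^ 'm \<Rightarrow> 'n set \<Rightarrow> (real ^ 'r::{finite,linorder} ^ ('n + ('m + 'm))) set" where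
  "feasible_set A b B =
     {R. block_matrix A ** R = outer (block_rhs b) e1 \<and>
         (\<forall>k\<in>B. (R ** transpose R) $ Inl k $ Inl k = (R *v e1) $ Inl k)}"

text \<open>The scalar constraint functions: \<open>Inl (i, j)\<close> names an entry of the linear system,
  \<open>Inr k\<close> a diagonal constraint.\<close>

fun constraint_fun ::
  "real ^ 'n ^ 'm \<Rightarrow> real ^ 'm \<Rightarrow> (('m + 'm) \<times> 'r) + 'n \<Rightarrow>
   real ^ 'r::{finite,linorder} ^ ('n + ('m + 'm)) \<Rightarrow> real" where
  "constraint_fun A b (Inl (i, j)) R = (block_matrix A ** R - outer (block_rhs b) e1) $ i $ j"
| "constraint_fun A b (Inr k) R = (R ** transpose R) $ Inl k $ Inl k - (R *v e1) $ Inl k"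

definition constraint_indices :: "'n set \<Rightarrow> ((('m + 'm) \<times> 'r) + 'n) set" where
  "constraint_indices B = UNIV <+> B"

text \<open>The gradients of \<open>h i\<close>, \<open>i \<in> I\<close>, at \<open>x\<close> exist and are linearly independent as a family: injectivity
  excludes repeated gradients, which independence of the set of gradients alone would not.\<close>

definition LICQ :: "'i set \<Rightarrow> ('i \<Rightarrow> 'a::real_inner \<Rightarrow> real) \<Rightarrow> 'a \<Rightarrow> bool" where
  "LICQ I h x \<longleftrightarrow>
     (\<exists>g. (\<forall>i\<in>I. GDERIV (h i) x :> g i) \<and> inj_on g I \<and> independent (g ` I))"

end

theory Submission
  imports Defs
begin

text \<open>Write \<open>A'\<close> for the block matrix. The gradient of the \<open>(i, j)\<close> entry of \<open>A' R - b' e1\<^sup>T\<close> is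
  the matrix whose column \<open>j\<close> is the \<open>i\<close>-th row of \<open>A'\<close> and whose other columns vanish; the gradient
  of the \<open>k\<close>-th diagonal constraint \<open>\<bar>R\<^sub>k\<bar>\<^sup>2 - R\<^sub>k \<bullet> e1\<close> is supported on row \<open>k\<close>, where it equals
  \<open>2 R\<^sub>k - e1\<close>.

  Take a linear combination of these gradients that vanishes. Diagonal gradients live in the first
  \<open>n\<close> rows only, so the last \<open>2m\<close> rows of the combination see just the linear constraints, and
  there the slack blocks \<open>I\<close> and \<open>-I\<close> exhibit each coefficient up to sign: all coefficients of the
  linear constraints are zero (\<open>slack_row_block_matrix\<close>). What remains in row \<open>k \<in> B\<close> is
  a multiple of \<open>2 R\<^sub>k - e1\<close>. This vector is nonzero, because the constraint says that \<open>R\<^sub>k\<close> lies on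
  the sphere with centre \<open>e1 / 2\<close> and radius \<open>1 / 2\<close>, of which \<open>e1 / 2\<close> is not a point
  (\<open>diagonal_gradient_nonzero\<close>).\<close>

text \<open>Coefficients are indexed by the family rather than by its range, so a repeated vector would
  itself give a nontrivial relation; hence injectivity comes out together with independence.\<close>

lemma independent_family_if_trivial_relations:
  fixes g :: "'i \<Rightarrow> 'a::real_vector"
  assumes fin: "finite I"
    and triv: "\<And>c. (\<Sum>i\<in>I. c i *\<^sub>R g i) = 0 \<Longrightarrow> \<forall>i\<in>I. c i = 0"
  shows "inj_on g I" and "independent (g ` I)"
proof -
  show inj: "inj_on g I"
  proof (rule inj_onI, rule ccontr)
    fix i j assume ij: "i \<in> I" "j \<in> I" "g i = g j" "i \<noteq> j"
    define c where "c k = (if k = i then 1 else 0) - (if k = j then 1 else (0::real))" for k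
    have "(\<Sum>k\<in>I. c k *\<^sub>R g k) = g i - g j"
      using ij(1,2) fin
      by (simp add: c_def scaleR_left_diff_distrib sum_subtractf if_distrib[of "\<lambda>x. x *\<^sub>R _"]
               cong: if_cong)
    then have "c i = 0" using triv[of c] ij by simp
    then show False using ij(4) by (simp add: c_def)
  qed
  show "independent (g ` I)"
  proof
    assume "dependent (g ` I)"
    then obtain u where u: "\<exists>v\<in>g ` I. u v \<noteq> 0" "(\<Sum>v\<in>g ` I. u v *\<^sub>R v) = 0"
      using dependent_finite[of "g ` I"] fin by auto
    have "(\<Sum>i\<in>I. u (g i) *\<^sub>R g i) = 0"
      using u(2) inj by (simp add: sum.reindex)
    then have "u (g i) = 0" if "i \<in> I" for i
      using triv[of "\<lambda>i. u (g i)"] that by blast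
    then show False using u(1) by blast
  qed
qed

lemma GDERIV_matrix_mult_entry:
  fixes M :: "real ^ 'k ^ 'l" and R C :: "real ^ 'r ^ _"
  shows "GDERIV (\<lambda>R. (M ** R - C) $ i $ j) R :> outer (M $ i) (axis j 1)"
proof -
  have entry: "(M ** X) $ i $ j = X \<bullet> outer (M $ i) (axis j 1)" for X :: "real ^ 'r ^ 'k"
    by (simp add: matrix_matrix_mult_def outer_def inner_vec_def axis_def mult_ac
        if_distrib[of "\<lambda>x. _ * x"] cong: if_cong)
  show ?thesis
    unfolding gderiv_def vector_minus_component entry
    by (auto intro!: derivative_eq_intros)
qed

lemma mult_transpose_diagonal: "((R :: real ^ 'r ^ 'k) ** transpose R) $ a $ a = R $ a \<bullet> R $ a"
  by (simp add: matrix_matrix_mult_def transpose_def inner_vec_def)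

lemma GDERIV_diagonal_constraint:
  fixes R :: "real ^ 'r ^ 'k"
  shows "GDERIV (\<lambda>R. (R ** transpose R) $ a $ a - (R *v e) $ a) R :> axis a (2 *\<^sub>R R $ a - e)"
  unfolding gderiv_def mult_transpose_diagonal matrix_vector_mul_component
  by (auto intro!: derivative_eq_intros bounded_linear.has_derivative[OF bounded_linear_vec_nth]
      simp: inner_axis inner_commute inner_diff_right)

text \<open>The points with \<open>x \<bullet> x = x \<bullet> e\<close> form the sphere having the segment from \<open>0\<close> to \<open>e\<close> as a
  diameter, and its centre \<open>e / 2\<close> is not on it.\<close>

lemma diagonal_gradient_nonzero:
  fixes x e :: "'a::real_inner"
  assumes "x \<bullet> x = x \<bullet> e" and "e \<noteq> 0"
  shows "2 *\<^sub>R x - e \<noteq> 0"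
proof
  assume "2 *\<^sub>R x - e = 0"
  then have "e = 2 *\<^sub>R x" by simp
  with assms show False by simp
qed

text \<open>The slack columns turn a combination of the rows of the block matrix into its coefficients, up
  to the sign of the block \<open>-I\<close>.\<close>

lemma slack_row_block_matrix:
  shows "(\<Sum>i\<in>UNIV. c i * block_matrix A $ i $ Inr q) =
    (case q of Inl p \<Rightarrow> c (Inl p) | Inr p \<Rightarrow> - c (Inr p))"
  by (cases q) (simp_all add: block_matrix_def UNIV_Plus_UNIV[symmetric] sum.Plus mat_def
      if_distrib[of "\<lambda>x. _ * x"] sum_negf cong: if_cong del: UNIV_Plus_UNIV)

fun constraint_gradient ::
  "real ^ 'n ^ 'm \<Rightarrow> real ^ 'r::{finite,linorder} ^ ('n + ('m + 'm)) \<Rightarrow>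
   (('m + 'm) \<times> 'r) + 'n \<Rightarrow> real ^ 'r::{finite,linorder} ^ ('n + ('m + 'm))" where
  "constraint_gradient A R (Inl (i, j)) = outer (block_matrix A $ i) (axis j 1)"
| "constraint_gradient A R (Inr k) = axis (Inl k) (2 *\<^sub>R R $ Inl k - e1)"

lemma GDERIV_constraint_fun: "GDERIV (constraint_fun A b i) R :> constraint_gradient A R i"
proof (cases i)
  case (Inl ij)
  obtain p j where "ij = (p, j)" by (cases ij)
  moreover from this have
    "constraint_fun A b i = (\<lambda>R. (block_matrix A ** R - outer (block_rhs b) e1) $ p $ j)"
    using Inl by (simp add: fun_eq_iff)
  ultimately show ?thesis
    using Inl by (simp only: constraint_gradient.simps GDERIV_matrix_mult_entry)
next
  case (Inr k)
  then have "constraint_fun A b i =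
      (\<lambda>R. (R ** transpose R) $ Inl k $ Inl k - (R *v e1) $ Inl k)"
    by (simp add: fun_eq_iff)
  with Inr show ?thesis
    by (simp only: constraint_gradient.simps GDERIV_diagonal_constraint)
qed

lemma sum_constraint_gradient_component:
  fixes A :: "real ^ 'n ^ 'm" and R :: "real ^ 'r::{finite,linorder} ^ ('n + ('m + 'm))"
  shows "(\<Sum>i\<in>constraint_indices B. c i *\<^sub>R constraint_gradient A R i) $ a $ l =
    (\<Sum>i\<in>UNIV. c (Inl (i, l)) * block_matrix A $ i $ a) +
    (\<Sum>k\<in>B. c (Inr k) * (if a = Inl k then (2 *\<^sub>R R $ Inl k - e1) $ l else 0))"
proof -
  have "(\<Sum>p\<in>UNIV. c (Inl p) * constraint_gradient A R (Inl p) $ a $ l) =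
      (\<Sum>i\<in>UNIV. \<Sum>j\<in>UNIV. if j = l then c (Inl (i, l)) * block_matrix A $ i $ a else 0)"
    unfolding sum.cartesian_product UNIV_Times_UNIV
    by (rule sum.cong) (auto simp: outer_def axis_def)
  then show ?thesis
    by (simp add: constraint_indices_def sum.Plus axis_def
        if_distrib[of "\<lambda>v. v $ l"] cong: if_cong)
qed

theorem lemma4:
  fixes A :: "real ^ 'n ^ 'm"
    and b :: "real ^ 'm"
    and B :: "'n set"
    and R :: "real ^ 'r::{finite,linorder} ^ ('n + ('m + 'm))"
  assumes "rank A = CARD('m)"
    and "\<forall>i. 0 \<le> b $ i"
    and "R \<in> feasible_set A b B"
  shows "LICQ (constraint_indices B) (constraint_fun A b) R"
proof -
  let ?g = "constraint_gradient A R"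
  have triv: "\<forall>i\<in>constraint_indices B. c i = 0"
    if rel: "(\<Sum>i\<in>constraint_indices B. c i *\<^sub>R ?g i) = 0" for c
  proof -
    have comp: "(\<Sum>i\<in>UNIV. c (Inl (i, l)) * block_matrix A $ i $ a) +
        (\<Sum>k\<in>B. c (Inr k) * (if a = Inl k then (2 *\<^sub>R R $ Inl k - e1) $ l else 0)) = 0" for a l
      unfolding sum_constraint_gradient_component[symmetric] rel by simp
    have linear: "c (Inl (q, l)) = 0" for q l
      using comp[where a = "Inr q" and l = l]
      by (simp add: slack_row_block_matrix split: sum.splits)
    have diagonal: "c (Inr k) = 0" if "k \<in> B" for k
    proof -
      have "c (Inr k) * (2 *\<^sub>R R $ Inl k - e1) $ l = 0" for l
        using comp[where a = "Inl k" and l = l] that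
        by (simp add: linear if_distrib[of "\<lambda>x. _ * x"] cong: if_cong)
      then have "c (Inr k) *\<^sub>R (2 *\<^sub>R R $ Inl k - e1) = 0"
        by (simp add: vec_eq_iff)
      moreover have "R $ Inl k \<bullet> R $ Inl k = R $ Inl k \<bullet> e1"
        using assms(3) that
        by (simp add: feasible_set_def mult_transpose_diagonal matrix_vector_mul_component)
      then have "2 *\<^sub>R R $ Inl k - e1 \<noteq> 0"
        by (rule diagonal_gradient_nonzero) (simp add: e1_def axis_eq_0_iff)
      ultimately show ?thesis by simp
    qed
    show ?thesis using linear diagonal by (auto simp: constraint_indices_def)
  qed
  have fin: "finite (constraint_indices B :: ((('m + 'm) \<times> 'r) + 'n) set)"
    by (simp add: constraint_indices_def)
  have "inj_on ?g (constraint_indices B)" "independent (?g ` constraint_indices B)"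
    using independent_family_if_trivial_relations[OF fin triv] by blast+
  then show ?thesis
    unfolding LICQ_def using GDERIV_constraint_fun by blast
qed

end
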